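(* Let $q=r^2$ where $r$ is an odd prime power, and let $q-1=e_1f_1=e_2f_2$ with positive integers $e_1,f_1,e_2,f_2$. Suppose there is an integer $l\geq 2$ with $e_1\equiv 2^l \pmod{2^{l+1}}$ and $2^l\mid e_2$. Suppose further that $2e_2\mid e_1(r-1)$ and $e_1\mid e_2(r+1)$. Let $D_1=\frac{e_1}{\gcd(e_1,e_2)}$, $D_2=\frac{e_2}{\gcd(e_1,e_2)}$, and let $s,t$ be integers with $1\leq s\leq D_1$, $1\leq t\leq D_2$ and $4\mid (s-1)(r+1)$. Put $n_1=sf_1+tf_2$. Then: (1) if $n_1$ is even, then for every $k$ with $1\leq k\leq \frac{n_1}{2}-1$ there exists a $q$-ary $[n_1,k]$ MDS self-orthogonal code; (2) if $n_1$ is even, there exists a $q$-ary MDS almost self-dual code of length $n_1+1$; (3) if $n_1+1$ is even, then for every $k$ with $1\leq k\leq \frac{n_1+1}{2}-1$ there exists a $q$-ary $[n_1+1,k]$ MDS self-orthogonal code.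
   Context: $\mathbb{F}_q$ denotes the finite field with $q$ elements. A linear code of length $n$ over $\mathbb{F}_q$ is a subspace of $\mathbb{F}_q^n$; an $[n,k]$ code has dimension $k$, and an $[n,k,d]$ code is MDS if its minimum Hamming distance is $d=n-k+1$. The (Euclidean) dual of a code $C$ is $C^\perp=\{x\in\mathbb{F}_q^n : \sum_i x_ic_i=0 \text{ for all } c\in C\}$. $C$ is self-orthogonal if $C\subseteq C^\perp$, and almost self-dual if $C\subseteq C^\perp$ and $\dim C^\perp=\dim C+1$. An MDS almost self-dual code is an almost self-dual code that is MDS. *)

theory Defs
  imports Complex_Main "HOL-Computational_Algebra.Primes" "HOL-Library.Function_Algebras"
begin

definition vecs :: "nat \<Rightarrow> (nat \<Rightarrow> 'a::field) set" where
  "vecs n = {x. \<forall>i\<ge>n. x i = 0}"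

definition vscale :: "'a::field \<Rightarrow> (nat \<Rightarrow> 'a) \<Rightarrow> (nat \<Rightarrow> 'a)" where
  "vscale c x = (\<lambda>i. c * x i)"

definition linear_code :: "nat \<Rightarrow> (nat \<Rightarrow> 'a::field) set \<Rightarrow> bool" where
  "linear_code n C \<longleftrightarrow> C \<subseteq> vecs n \<and> module.subspace vscale C"

definition code_dim :: "(nat \<Rightarrow> 'a::field) set \<Rightarrow> nat" where
  "code_dim C = vector_space.dim vscale C"

definition hamming_wt :: "nat \<Rightarrow> (nat \<Rightarrow> 'a::field) \<Rightarrow> nat" where
  "hamming_wt n x = card {i. i < n \<and> x i \<noteq> 0}"

definition min_dist :: "nat \<Rightarrow> (nat \<Rightarrow> 'a::field) set \<Rightarrow> nat" where
  "min_dist n C = Min (hamming_wt n ` (C - {0}))"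

definition dual_code :: "nat \<Rightarrow> (nat \<Rightarrow> 'a::field) set \<Rightarrow> (nat \<Rightarrow> 'a) set" where
  "dual_code n C = {x \<in> vecs n. \<forall>c\<in>C. (\<Sum>i<n. x i * c i) = 0}"

definition MDS_code :: "nat \<Rightarrow> nat \<Rightarrow> (nat \<Rightarrow> 'a::field) set \<Rightarrow> bool" where
  "MDS_code n k C \<longleftrightarrow> linear_code n C \<and> code_dim C = k \<and> min_dist n C = n - k + 1"

definition self_orthogonal :: "nat \<Rightarrow> (nat \<Rightarrow> 'a::field) set \<Rightarrow> bool" where
  "self_orthogonal n C \<longleftrightarrow> C \<subseteq> dual_code n C"

definition almost_self_dual :: "nat \<Rightarrow> (nat \<Rightarrow> 'a::field) set \<Rightarrow> bool" where
  "almost_self_dual n C \<longleftrightarrow> C \<subseteq> dual_code n C \<and> code_dim (dual_code n C) = code_dim C + 1"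

end

theory Submission
  imports Defs "HOL-Computational_Algebra.Polynomial" "HOL-Number_Theory.Residues"
begin

text \<open>
  A generalised Reed--Solomon code with distinct evaluation points \<open>a\<^sub>i\<close> and multipliers \<open>v\<^sub>i\<close>
  satisfying \<open>v\<^sub>i\<^sup>2 \<cdot> \<Prod>j\<noteq>i. (a\<^sub>i - a\<^sub>j) = 1\<close> is MDS, and by Lagrange interpolation the dual of
  its \<open>k\<close>-dimensional member is its \<open>(n - k)\<close>-dimensional one. So it suffices to find \<open>n1\<close> nonzero
  squares all of whose difference products are squares; since \<open>- 1\<close> is a square, the point \<open>0\<close>
  may then be added.

  Let \<open>\<theta>\<close> be a primitive element. Take \<open>A\<close> to be the union of the \<open>s\<close> cosets
  \<open>\<theta> ^ (e2 * i) * \<langle>\<theta> ^ e1\<rangle>\<close> and \<open>B\<close> the union of the \<open>t\<close> cosets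
  \<open>\<theta> ^ (e1 div 2 + e1 * j) * \<langle>\<theta> ^ e2\<rangle>\<close>. For a point \<open>x\<close> of either set, \<open>x ^ f1\<close> has norm one over
  the subfield of order \<open>r\<close>, while \<open>x ^ f2\<close> lies in that subfield, all of whose nonzero elements
  are squares. The difference products of \<open>A \<union> B\<close> factor into differences of such powers.
  The half step \<open>e1 div 2\<close> makes \<open>A\<close> and \<open>B\<close> disjoint, because \<open>2 ^ l\<close> does not divide it, and
  its contribution \<open>\<theta> ^ (e1 div 2 * f1) = - 1\<close> is just the sign that makes \<open>\<Prod>y\<in>A. (x - y)\<close> a
  square for \<open>x \<in> B\<close>.
\<close>

hide_const (open) up_ring.monom up_ring.coeff Module.module.smult

section \<open>Generalised Reed--Solomon codes\<close>

interpretation code_space: vector_space "vscale :: 'a::field \<Rightarrow> (nat \<Rightarrow> 'a) \<Rightarrow> nat \<Rightarrow> 'a"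
  by unfold_locales (auto simp: vscale_def fun_eq_iff algebra_simps)

locale grs =
  fixes n :: nat and a v :: "nat \<Rightarrow> 'a::field"
  assumes inj: "inj_on a {..<n}" and nz: "i < n \<Longrightarrow> v i \<noteq> 0"
begin

text \<open>Words are padded with 0 from position \<open>n\<close> on, as \<open>vecs n\<close>
  requires. The multipliers \<open>v i\<close> leave Hamming weights unchanged; their purpose is to
  normalise the inner product.\<close>

definition enc :: "'a poly \<Rightarrow> nat \<Rightarrow> 'a" where
  "enc p = (\<lambda>i. if i < n then v i * poly p (a i) else 0)"

definition code :: "nat \<Rightarrow> (nat \<Rightarrow> 'a) set" where
  "code k = enc ` {p. degree p < k}"

lemma enc_0: "enc 0 = 0"
  by (auto simp: enc_def)

lemma enc_add: "enc (p + q) = enc p + enc q"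
  by (auto simp: enc_def fun_eq_iff algebra_simps)

lemma enc_smult: "enc (smult c p) = vscale c (enc p)"
  by (auto simp: enc_def vscale_def fun_eq_iff)

lemma enc_sum: "enc (sum f A) = (\<Sum>x\<in>A. enc (f x))"
  by (induction A rule: infinite_finite_induct) (auto simp: enc_0 enc_add)

lemma card_points: "card (a ` {..<n}) = n"
  using card_image[OF inj] by simp

lemma poly_eq_on_points:
  assumes "degree p < n" "degree q < n" "\<And>i. i < n \<Longrightarrow> poly p (a i) = poly q (a i)"
  shows "p = q"
  by (rule poly_eqI_degree[of "a ` {..<n}"]) (use assms card_points in auto)

lemma enc_inj:
  assumes "degree p < n" "degree q < n" "enc p = enc q"
  shows "p = q"
proof (rule poly_eq_on_points)
  fix i assume "i < n"
  with fun_cong[OF assms(3), of i] nz show "poly p (a i) = poly q (a i)"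
    by (simp add: enc_def)
qed (use assms in auto)

lemma linear_code: "k \<ge> 1 \<Longrightarrow> linear_code n (code k)"
  unfolding linear_code_def
proof (intro conjI)
  show "code k \<subseteq> vecs n"
    by (auto simp: code_def enc_def vecs_def)
  show "module.subspace vscale (code k)" if "k \<ge> 1"
  proof (rule code_space.subspaceI)
    show "0 \<in> code k"
      unfolding code_def using that enc_0 by (intro image_eqI[of _ _ 0]) auto
  next
    fix x y assume "x \<in> code k" "y \<in> code k"
    then obtain p q where "x = enc p" "y = enc q" "degree p < k" "degree q < k"
      by (auto simp: code_def)
    then show "x + y \<in> code k"
      unfolding code_def by (intro image_eqI[of _ _ "p + q"]) (auto simp: enc_add degree_add_less)
  next
    fix c x assume "x \<in> code k"
    then obtain p where "x = enc p" "degree p < k"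
      by (auto simp: code_def)
    then show "vscale c x \<in> code k"
      unfolding code_def
      by (intro image_eqI[of _ _ "smult c p"]) (auto simp: enc_smult intro: le_less_trans[OF degree_smult_le])
  qed
qed

text \<open>The encoded monomials of degree below \<open>k\<close> form a basis: since
  \<open>k \<le> n\<close>, \<open>enc\<close> is injective on polynomials of degree below
  \<open>k\<close>.\<close>

lemma code_dim:
  assumes "1 \<le> k" "k \<le> n"
  shows "code_dim (code k) = k"
proof -
  let ?e = "\<lambda>j. enc (monom 1 j)"
  have expand: "enc (\<Sum>j<k. monom (c j) j) = (\<Sum>j<k. vscale (c j) (?e j))" for c
    by (simp add: enc_sum flip: enc_smult add: smult_monom)
  have deg: "degree (\<Sum>j<k. monom (c j) j) < k" for c :: "nat \<Rightarrow> 'a"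
    using assms by (intro degree_sum_less) (auto intro: le_less_trans[OF degree_monom_le])
  have inj_e: "inj_on ?e {..<k}"
  proof (rule inj_onI)
    fix i j assume "i \<in> {..<k}" "j \<in> {..<k}" "?e i = ?e j"
    then have "monom (1::'a) i = monom 1 j"
      using assms by (intro enc_inj) (auto simp: degree_monom_eq)
    then show "i = j"
      by (metis degree_monom_eq zero_neq_one)
  qed
  have "code_space.dim (code k) = k"
  proof (rule code_space.dim_unique)
    show "?e ` {..<k} \<subseteq> code k"
      by (auto simp: code_def degree_monom_eq)
    show "code k \<subseteq> code_space.span (?e ` {..<k})"
    proof
      fix x assume "x \<in> code k"
      then obtain p where p: "x = enc p" "degree p < k"
        by (auto simp: code_def)
      have "(\<Sum>j<k. monom (coeff p j) j) = p"
        using p(2) by (intro poly_eqI) (auto simp: coeff_sum coeff_eq_0)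
      then have "x = (\<Sum>j<k. vscale (coeff p j) (?e j))"
        using p expand[of "coeff p"] by simp
      then show "x \<in> code_space.span (?e ` {..<k})"
        by (simp only:) (intro code_space.span_sum code_space.span_scale code_space.span_base, auto)
    qed
    show "code_space.independent (?e ` {..<k})"
    proof (rule code_space.independent_if_scalars_zero)
      fix f x
      assume "(\<Sum>x\<in>?e ` {..<k}. vscale (f x) x) = 0" and x: "x \<in> ?e ` {..<k}"
      then have "enc (\<Sum>j<k. monom (f (?e j)) j) = enc 0"
        by (simp add: expand sum.reindex[OF inj_e] enc_0)
      then have "(\<Sum>j<k. monom (f (?e j)) j) = 0"
        using deg[of "\<lambda>j. f (?e j)"] assms by (intro enc_inj) auto
      then have "coeff (\<Sum>j<k. monom (f (?e j)) j) i = 0" for i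
        by simp
      then have "(if i < k then f (?e i) else 0) = 0" for i
        by (simp add: coeff_sum)
      then show "f x = 0"
        using x by (metis (no_types, lifting) imageE lessThan_iff)
    qed auto
    show "card (?e ` {..<k}) = k"
      using card_image[OF inj_e] by simp
  qed
  then show ?thesis
    by (simp add: code_dim_def)
qed

lemma hamming_wt_enc: "hamming_wt n (enc p) = n - card {i. i < n \<and> poly p (a i) = 0}"
proof -
  have "{i. i < n \<and> enc p i \<noteq> 0} = {..<n} - {i. i < n \<and> poly p (a i) = 0}"
    using nz by (auto simp: enc_def)
  also have "card \<dots> = n - card {i. i < n \<and> poly p (a i) = 0}"
    by (subst card_Diff_subset) auto
  finally show ?thesis
    by (simp add: hamming_wt_def)
qed

text \<open>A nonzero polynomial of degree below \<open>k\<close> has at most \<open>k - 1\<close>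
  roots among the distinct points, and some polynomial attains this number.\<close>

lemma min_dist:
  assumes "1 \<le> k" "k \<le> n"
  shows "min_dist n (code k) = n - k + 1"
  unfolding min_dist_def
proof (rule Min_eqI)
  \<comment> \<open>\<open>Min\<close> needs a finite set: the code may be infinite, but its weights
    are bounded by \<open>n\<close>.\<close>
  have "hamming_wt n x \<le> n" for x :: "nat \<Rightarrow> 'a"
    using card_mono[of "{..<n}" "{i. i < n \<and> x i \<noteq> 0}"] by (auto simp: hamming_wt_def)
  then show "finite (hamming_wt n ` (code k - {0}))"
    by (metis atMost_iff finite_atMost finite_subset image_subsetI)
next
  fix w assume "w \<in> hamming_wt n ` (code k - {0})"
  then obtain p where p: "w = hamming_wt n (enc p)" "degree p < k" "p \<noteq> 0"
    using enc_0 by (auto simp: code_def)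
  have "card {i. i < n \<and> poly p (a i) = 0} = card (a ` {i. i < n \<and> poly p (a i) = 0})"
    by (intro card_image[symmetric] inj_on_subset[OF inj]) auto
  also have "\<dots> \<le> card {x. poly p x = 0}"
    using p by (intro card_mono poly_roots_finite) auto
  also have "\<dots> \<le> degree p"
    using p by (intro card_poly_roots_bound) auto
  finally show "n - k + 1 \<le> w"
    using p assms by (simp add: hamming_wt_enc)
next
  \<comment> \<open>Vanishing at exactly the first \<open>k - 1\<close> points gives a word of least
    weight.\<close>
  define p where "p = (\<Prod>j<k-1. [:- a j, 1:])"
  have zeros: "{i. i < n \<and> poly p (a i) = 0} = {..<k-1}"
  proof -
    have "poly p (a i) = 0 \<longleftrightarrow> i < k - 1" if "i < n" for i
    proof -
      have "poly p (a i) = 0 \<longleftrightarrow> (\<exists>j<k-1. a i = a j)"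
        by (auto simp: p_def poly_prod)
      also have "\<dots> \<longleftrightarrow> (\<exists>j<k-1. i = j)"
        using assms that inj_onD[OF inj, of i] by (intro ex_cong1 conj_cong) auto
      finally show ?thesis by simp
    qed
    then show ?thesis
      using assms by auto
  qed
  have "degree p = k - 1"
    unfolding p_def by (subst degree_prod_eq_sum_degree) auto
  then have "enc p \<in> code k"
    using assms by (auto simp: code_def)
  moreover have wt: "hamming_wt n (enc p) = n - k + 1"
    using assms by (simp add: hamming_wt_enc zeros)
  moreover have "enc p \<noteq> 0"
  proof
    assume "enc p = 0"
    with wt show False by (simp add: hamming_wt_def)
  qed
  ultimately show "n - k + 1 \<in> hamming_wt n ` (code k - {0})"
    by (intro image_eqI[of _ _ "enc p"]) simp_all
qed

lemma MDS_code: "1 \<le> k \<Longrightarrow> k \<le> n \<Longrightarrow> MDS_code n k (code k)"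
  by (simp add: MDS_code_def linear_code code_dim min_dist)

section \<open>Lagrange interpolation and dual codes\<close>

definition weight :: "nat \<Rightarrow> 'a" where
  "weight i = inverse (\<Prod>j\<in>{..<n}-{i}. a i - a j)"

text \<open>Each basis polynomial \<open>L i\<close> is monic of degree \<open>n - 1\<close>, and
  \<open>weight i\<close> normalises its value at \<open>a i\<close> to 1. Hence the coefficient of
  the interpolant at \<open>n - 1\<close> is the weighted sum of the values.\<close>

lemma lagrange:
  assumes "n > 0"
  obtains h where "degree h < n" "\<And>i. i < n \<Longrightarrow> poly h (a i) = y i"
    "coeff h (n - 1) = (\<Sum>i<n. weight i * y i)"
proof -
  define L where "L i = (\<Prod>j\<in>{..<n}-{i}. [:- a j, 1:])" for i
  define h where "h = (\<Sum>i<n. smult (weight i * y i) (L i))"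
  have deg_L: "degree (L i) = n - 1" and coeff_L: "coeff (L i) (n - 1) = 1" if "i < n" for i
  proof -
    show *: "degree (L i) = n - 1"
      unfolding L_def using that by (subst degree_prod_eq_sum_degree) auto
    show "coeff (L i) (n - 1) = 1"
      unfolding *[symmetric] by (simp add: L_def lead_coeff_prod)
  qed
  have poly_L: "weight i * poly (L i) (a m) = (if i = m then 1 else 0)" if "i < n" "m < n" for i m
  proof -
    have "(\<Prod>j\<in>{..<n}-{i}. a i - a j) \<noteq> 0"
      using inj that by (auto simp: inj_on_def)
    moreover have "(\<Prod>j\<in>{..<n}-{i}. a m - a j) = 0" if "i \<noteq> m"
      using that \<open>m < n\<close> by auto
    ultimately show ?thesis
      by (auto simp: L_def poly_prod weight_def)
  qed
  show thesis
  proof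
    show "degree h < n"
      unfolding h_def using assms
      by (intro degree_sum_less) (auto intro!: le_less_trans[OF degree_smult_le] simp: deg_L)
    show "coeff h (n - 1) = (\<Sum>i<n. weight i * y i)"
      unfolding h_def coeff_sum by (intro sum.cong) (auto simp: coeff_L[simplified])
    fix m assume "m < n"
    have "poly h (a m) = (\<Sum>i<n. y i * (weight i * poly (L i) (a m)))"
      by (simp add: h_def poly_sum mult_ac)
    also have "\<dots> = (\<Sum>i<n. if i = m then y i else 0)"
      using \<open>m < n\<close> by (intro sum.cong refl) (auto simp: poly_L)
    finally show "poly h (a m) = y m"
      using \<open>m < n\<close> by simp
  qed
qed

text \<open>By uniqueness, interpolating the values of \<open>h\<close> returns \<open>h\<close>
  itself.\<close>

lemma sum_weight_poly:
  assumes "degree h < n"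
  shows "(\<Sum>i<n. weight i * poly h (a i)) = coeff h (n - 1)"
proof -
  have "n > 0" using assms by simp
  from lagrange[OF this, of "\<lambda>i. poly h (a i)"] obtain g where
    g: "degree g < n" "\<And>i. i < n \<Longrightarrow> poly g (a i) = poly h (a i)"
      "coeff g (n - 1) = (\<Sum>i<n. weight i * poly h (a i))" by blast
  then have "g = h"
    using assms by (intro poly_eq_on_points) auto
  with g show ?thesis by simp
qed

end

text \<open>With these multipliers the inner product of two encodings is a weighted sum of values of
  the product polynomial, so it reads off one coefficient.\<close>

locale self_dual_grs = grs +
  assumes weight_sq: "i < n \<Longrightarrow> v i ^ 2 = weight i"
begin

lemma inner_enc:
  assumes "degree (p * q) < n"
  shows "(\<Sum>i<n. enc p i * enc q i) = coeff (p * q) (n - 1)"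
proof -
  have "(\<Sum>i<n. enc p i * enc q i) = (\<Sum>i<n. weight i * poly (p * q) (a i))"
    by (intro sum.cong) (auto simp: enc_def weight_sq[symmetric] power2_eq_square)
  with sum_weight_poly[OF assms] show ?thesis by simp
qed

text \<open>Complementary degree bounds keep the product below degree \<open>n - 1\<close>, so its
  coefficient there vanishes. Conversely, a word encoding too large a degree is detected by a
  monomial.\<close>

lemma dual_code:
  assumes "1 \<le> k" "k < n"
  shows "dual_code n (code k) = code (n - k)"
proof (intro equalityI subsetI)
  fix x assume "x \<in> code (n - k)"
  then obtain p where p: "x = enc p" "degree p < n - k"
    by (auto simp: code_def)
  have "(\<Sum>i<n. x i * c i) = 0" if "c \<in> code k" for c
  proof -
    from that obtain q where q: "c = enc q" "degree q < k"
      by (auto simp: code_def)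
    have "degree (p * q) < n - 1"
      using p q assms by (intro le_less_trans[OF degree_mult_le]) auto
    then show ?thesis
      using p q by (simp add: inner_enc coeff_eq_0)
  qed
  moreover have "x \<in> vecs n"
    by (auto simp: p enc_def vecs_def)
  ultimately show "x \<in> dual_code n (code k)"
    by (auto simp: dual_code_def)
next
  fix x assume x: "x \<in> dual_code n (code k)"
  obtain h where h: "degree h < n" "\<And>i. i < n \<Longrightarrow> poly h (a i) = x i / v i"
    using lagrange[of "\<lambda>i. x i / v i"] assms by (metis less_nat_zero_code not_gr_zero)
  have xh: "x = enc h"
    using x nz h(2) by (auto simp: enc_def dual_code_def vecs_def fun_eq_iff not_less)
  have "degree h < n - k"
  proof (rule ccontr)
    assume neg: "\<not> degree h < n - k"
    \<comment> \<open>Multiplication by the monomial of degree \<open>j < k\<close> lifts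
      \<open>h\<close> to degree exactly \<open>n - 1\<close>, so the inner product is the leading
      coefficient of \<open>h\<close>.\<close>
    define j where "j = n - 1 - degree h"
    have j: "j < k" "n - 1 = j + degree h"
      using neg h(1) assms by (auto simp: j_def)
    have "h \<noteq> 0"
      using neg assms by auto
    then have deg: "degree (h * monom 1 j) = n - 1"
      using j by (simp add: degree_mult_eq degree_monom_eq)
    have "enc (monom 1 j) \<in> code k"
      using j by (auto simp: code_def degree_monom_eq)
    then have "0 = (\<Sum>i<n. enc h i * enc (monom 1 j) i)"
      using x by (auto simp: dual_code_def xh)
    also have "\<dots> = coeff (h * monom 1 j) (n - 1)"
      using deg assms by (intro inner_enc) auto
    also have "\<dots> \<noteq> 0"
      unfolding deg[symmetric] using \<open>h \<noteq> 0\<close> by simp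
    finally show False by simp
  qed
  then show "x \<in> code (n - k)"
    by (auto simp: xh code_def)
qed

lemma code_mono: "k \<le> m \<Longrightarrow> code k \<subseteq> code m"
  by (auto simp: code_def)

lemma self_orthogonal:
  assumes "1 \<le> k" "2 * k \<le> n"
  shows "self_orthogonal n (code k)"
  using assms by (simp add: self_orthogonal_def dual_code code_mono)

lemma almost_self_dual:
  assumes "1 \<le> k" "n = 2 * k + 1"
  shows "almost_self_dual n (code k)"
proof -
  have "n - k = k + 1" "k < n"
    using assms by auto
  then show ?thesis
    using assms(1) code_mono[of k "k + 1"] dual_code[of k] code_dim[of k] code_dim[of "k + 1"]
    by (simp add: almost_self_dual_def)
qed

end

text \<open>Inverses of square roots of the difference products serve as multipliers: their squares
  are the Lagrange weights.\<close>

lemma square_products_self_dual_grs: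
  fixes S :: "'a::field set"
  assumes fin: "finite S"
    and sq: "\<And>x. x \<in> S \<Longrightarrow> \<exists>w. w ^ 2 = (\<Prod>y\<in>S-{x}. x - y)"
  obtains a v :: "nat \<Rightarrow> 'a" where "self_dual_grs (card S) a v"
proof -
  obtain a where a: "bij_betw a {..<card S} S"
    using ex_bij_betw_nat_finite[OF fin] by (auto simp: atLeast0LessThan)
  obtain w where w: "\<And>x. x \<in> S \<Longrightarrow> w x ^ 2 = (\<Prod>y\<in>S-{x}. x - y)"
    using sq by metis
  define v where "v i = inverse (w (a i))" for i
  have aS: "a i \<in> S" if "i < card S" for i
    using bij_betwE[OF a] that by auto
  interpret grs "card S" a v
  proof
    show "inj_on a {..<card S}"
      using a by (auto simp: bij_betw_def)
    fix i assume "i < card S"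
    then have "w (a i) ^ 2 \<noteq> 0"
      using w[OF aS] fin by simp
    then show "v i \<noteq> 0"
      by (auto simp: v_def)
  qed
  have "self_dual_grs (card S) a v"
  proof
    fix i assume i: "i < card S"
    have "(\<Prod>y\<in>S-{a i}. a i - y) = (\<Prod>j\<in>{..<card S}-{i}. a i - a j)"
      using i a by (intro prod.reindex_bij_betw[symmetric] bij_betw_DiffI)
        (auto simp: bij_betw_def)
    then show "v i ^ 2 = weight i"
      using w[OF aS[OF i]] by (simp add: v_def weight_def power_inverse)
  qed
  then show thesis using that by blast
qed

section \<open>Unions of cosets in a cyclic multiplicative group\<close>

lemma ex_power_generator:
  "\<exists>\<theta> :: 'a::{finite,field}. \<theta> \<noteq> 0 \<and> (\<forall>x. x \<noteq> 0 \<longrightarrow> (\<exists>i. x = \<theta> ^ i))"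
proof -
  \<comment> \<open>The field type is viewed as an explicit ring structure, to which cyclicity of
    the multiplicative group of a finite field applies.\<close>
  define R :: "'a ring" where
    "R = \<lparr>carrier = UNIV, mult = (*), one = 1, zero = 0, add = (+)\<rparr>"
  have R: "carrier R = UNIV" "\<zero>\<^bsub>R\<^esub> = 0" "\<one>\<^bsub>R\<^esub> = 1" "x \<otimes>\<^bsub>R\<^esub> y = x * y" "x \<oplus>\<^bsub>R\<^esub> y = x + y" for x y
    by (simp_all add: R_def)
  have "cring R"
  proof (rule cringI)
    show "abelian_group R"
      by (rule abelian_groupI) (auto simp: R algebra_simps intro: exI[of _ "- _"])
    show "comm_monoid R"
      by (rule comm_monoidI) (auto simp: R)
  qed (auto simp: R algebra_simps)
  then interpret cring R .
  interpret field R
  proof (rule cring_fieldI)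
    have "x \<in> Units R" if "x \<noteq> 0" for x
      using that by (auto simp: Units_def R intro!: exI[of _ "inverse x"])
    moreover have "x \<noteq> 0" if "x \<in> Units R" for x
      using that by (auto simp: Units_def R)
    ultimately show "Units R = carrier R - {\<zero>\<^bsub>R\<^esub>}"
      by (auto simp: R)
  qed
  have pow: "x [^]\<^bsub>R\<^esub> (i::nat) = x ^ i" for x i
    by (induction i) (auto simp: R nat_pow_def)
  from finite_field_mult_group_has_gen obtain \<theta> where
    "\<theta> \<in> carrier (mult_of R)" "carrier (mult_of R) = {\<theta> [^]\<^bsub>R\<^esub> i |i::nat. i \<in> UNIV}"
    by (auto simp: R)
  then have "\<theta> \<noteq> 0 \<and> (\<forall>x. x \<noteq> 0 \<longrightarrow> (\<exists>i. x = \<theta> ^ i))"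
    by (auto simp: R pow set_eq_iff)
  then show ?thesis ..
qed

text \<open>Both sides are monic of degree \<open>f\<close> and vanish on the fibre, which has the
  full size \<open>f\<close>.\<close>

lemma prod_power_fibre:
  fixes z :: "'a::field"
  assumes "f > 0" and card: "card {y. y ^ f = z} = f"
  shows "(\<Prod>y | y ^ f = z. [:- y, 1:]) = monom 1 f - [:z:]"
proof -
  have fin: "finite {y. y ^ f = z}"
    using assms by (intro card_ge_0_finite) simp
  have deg: "degree (\<Prod>y | y ^ f = z. [:- y, 1:]) = f"
    using card by (subst degree_prod_eq_sum_degree) auto
  show ?thesis
  proof (rule poly_eqI_degree_lead_coeff[where n = f and A = "{y. y ^ f = z}"])
    have "coeff (\<Prod>y | y ^ f = z. [:- y, 1:]) f = 1"
      by (subst (2) deg[symmetric]) (simp add: lead_coeff_prod)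
    also have "1 = coeff (monom 1 f - [:z:]) f"
      using assms by (cases f) auto
    finally show "coeff (\<Prod>y | y ^ f = z. [:- y, 1:]) f = coeff (monom 1 f - [:z:]) f" .
    show "degree (monom 1 f - [:z:]) \<le> f"
      by (intro degree_diff_le) (auto intro: degree_monom_le)
  next
    fix x assume "x \<in> {y. y ^ f = z}"
    then have "poly (\<Prod>y | y ^ f = z. [:- y, 1:]) x = 0"
      using fin by (simp add: poly_prod)
    with \<open>x \<in> _\<close> show "poly (\<Prod>y | y ^ f = z. [:- y, 1:]) x = poly (monom 1 f - [:z:]) x"
      by (simp add: poly_monom)
  qed (use deg card in auto)
qed

lemma prod_power_fibre_eval:
  fixes z :: "'a::field"
  assumes "f > 0" and "card {y. y ^ f = z} = f"
  shows "(\<Prod>y | y ^ f = z. x - y) = x ^ f - z"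
  using arg_cong[OF prod_power_fibre[OF assms], of "\<lambda>p. poly p x"]
  by (simp add: poly_prod poly_monom)

text \<open>Differentiate the factorisation of \<open>monom 1 f - [:x ^ f:]\<close> at its root
  \<open>x\<close>: only the cofactor of \<open>[:- x, 1:]\<close> survives.\<close>

lemma prod_power_fibre_deriv:
  fixes x :: "'a::field"
  assumes "f > 0" and card: "card {y. y ^ f = x ^ f} = f"
  shows "(\<Prod>y\<in>{y. y ^ f = x ^ f} - {x}. x - y) = of_nat f * x ^ (f - 1)"
proof -
  have fin: "finite {y. y ^ f = x ^ f}"
    using assms by (intro card_ge_0_finite) simp
  define p where "p = (\<Prod>y\<in>{y. y ^ f = x ^ f} - {x}. [:- y, 1:])"
  have "[:- x, 1:] * p = monom 1 f - [:x ^ f:]"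
    unfolding p_def prod_power_fibre[OF assms, symmetric] using fin
    by (subst prod.remove[of _ x]) auto
  then have "poly (pderiv ([:- x, 1:] * p)) x = poly (pderiv (monom 1 f - [:x ^ f:])) x"
    by simp
  then have "poly p x = of_nat f * x ^ (f - 1)"
    unfolding pderiv_mult by (simp add: pderiv_diff pderiv_monom pderiv_pCons poly_monom)
  then show ?thesis
    by (simp add: p_def poly_prod)
qed

section \<open>Squares and powers of a primitive element\<close>

definition nonzero_square :: "'a::field \<Rightarrow> bool" where
  "nonzero_square x \<longleftrightarrow> (\<exists>w. w \<noteq> 0 \<and> x = w ^ 2)"

lemma nonzero_square_mult: "nonzero_square x \<Longrightarrow> nonzero_square y \<Longrightarrow> nonzero_square (x * y)"
  unfolding nonzero_square_def by (metis mult_eq_0_iff power_mult_distrib)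

lemma nonzero_square_1: "nonzero_square 1"
  unfolding nonzero_square_def by (intro exI[of _ 1]) auto

lemma nonzero_square_power: "nonzero_square x \<Longrightarrow> nonzero_square (x ^ n)"
  by (induction n) (auto intro: nonzero_square_mult nonzero_square_1)

lemma nonzero_square_prod: "(\<And>i. i \<in> A \<Longrightarrow> nonzero_square (g i)) \<Longrightarrow> nonzero_square (prod g A)"
  by (induction A rule: infinite_finite_induct) (auto intro: nonzero_square_mult nonzero_square_1)

locale primitive_element =
  fixes \<theta> :: "'a::{finite,field}" and N :: nat
  assumes gen: "x \<noteq> 0 \<Longrightarrow> \<exists>i. x = \<theta> ^ i"
    and theta_nz: "\<theta> \<noteq> 0"
    and N: "N = card (UNIV :: 'a set) - 1"
begin

lemma card_nonzero: "card (UNIV - {0 :: 'a}) = N"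
  by (simp add: N)

lemma N_pos: "N > 0"
proof -
  have "1 \<in> UNIV - {0 :: 'a}"
    by simp
  then have "card (UNIV - {0 :: 'a}) > 0"
    using card_gt_0_iff finite by blast
  then show ?thesis
    unfolding card_nonzero .
qed

text \<open>Multiplication by \<open>x\<close> permutes the nonzero elements, so the factor
  \<open>x ^ N\<close> does not change their product.\<close>

lemma power_N:
  assumes "x \<noteq> (0 :: 'a)"
  shows "x ^ N = 1"
proof -
  have "x ^ N * \<Prod>(UNIV - {0}) = (\<Prod>y\<in>UNIV-{0}. x * y)"
    by (simp add: prod.distrib card_nonzero)
  also have "\<dots> = \<Prod>(UNIV - {0})"
    by (rule prod.reindex_bij_witness[of _ "\<lambda>y. y / x" "\<lambda>y. x * y"]) (use assms in auto)
  finally show ?thesis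
    by simp
qed

lemma power_mod_N: "\<theta> ^ (i mod N) = \<theta> ^ i"
proof -
  have "\<theta> ^ i = \<theta> ^ (N * (i div N) + i mod N)"
    by simp
  also have "\<dots> = \<theta> ^ (i mod N)"
    by (simp only: power_add power_mult power_N[OF theta_nz]) simp
  finally show ?thesis ..
qed

text \<open>The \<open>N\<close> exponents below \<open>N\<close> already reach all \<open>N\<close>
  nonzero elements, so no two of them collide.\<close>

lemma inj_power: "inj_on (\<lambda>i. \<theta> ^ i) {..<N}"
proof (rule eq_card_imp_inj_on)
  have "(\<lambda>i. \<theta> ^ i) ` {..<N} = UNIV - {0}"
  proof (intro equalityI subsetI)
    fix x :: 'a assume "x \<in> UNIV - {0}"
    then obtain i where "x = \<theta> ^ (i mod N)"
      using gen power_mod_N by force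
    then show "x \<in> (\<lambda>i. \<theta> ^ i) ` {..<N}"
      using N_pos by auto
  qed (use theta_nz in auto)
  then show "card ((\<lambda>i. \<theta> ^ i) ` {..<N}) = card {..<N}"
    using card_nonzero by simp
qed auto

lemma power_eq_iff: "\<theta> ^ i = \<theta> ^ j \<longleftrightarrow> i mod N = j mod N"
  using inj_onD[OF inj_power, of "i mod N" "j mod N"] N_pos power_mod_N
  by (metis lessThan_iff mod_less_divisor)

lemma power_eq_1_iff: "\<theta> ^ i = 1 \<longleftrightarrow> N dvd i"
  using power_eq_iff[of i 0] by (simp add: mod_eq_0_iff_dvd)

lemma power_even_square: "even i \<Longrightarrow> nonzero_square (\<theta> ^ i)"
  unfolding nonzero_square_def using theta_nz by (metis evenE mult.commute power_mult power_not_zero)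

text \<open>Euler's criterion: for \<open>x = \<theta> ^ i\<close> the hypothesis gives
  \<open>2 * M dvd i * M\<close>, so \<open>i\<close> is even.\<close>

lemma euler_square:
  assumes "N = 2 * M" "x ^ M = (1 :: 'a)"
  shows "nonzero_square x"
proof -
  have "M > 0" using N_pos assms by simp
  then have "x \<noteq> 0" using assms by (auto simp: power_0_left)
  then obtain i where i: "x = \<theta> ^ i" using gen by blast
  then have "2 * M dvd i * M"
    using assms power_eq_1_iff[of "i * M"] by (simp add: power_mult)
  then have "even i"
    using \<open>M > 0\<close> by simp
  with i power_even_square show ?thesis by simp
qed

lemma half_power: "N = 2 * M \<Longrightarrow> (-1 :: 'a) \<noteq> 1 \<Longrightarrow> \<theta> ^ M = -1"
proof -
  assume M: "N = 2 * M" and "(-1 :: 'a) \<noteq> 1"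
  have "(\<theta> ^ M) ^ 2 = 1"
    using power_N[OF theta_nz] by (simp add: M mult.commute flip: power_mult)
  moreover have "\<theta> ^ M \<noteq> 1"
    using N_pos M by (auto simp: power_eq_1_iff dest: dvd_imp_le)
  ultimately show ?thesis
    by (simp add: power2_eq_1_iff)
qed

text \<open>If \<open>f\<close> divides \<open>N\<close>, this is the union of the cosets of the subgroup of order \<open>f\<close>
  represented by \<open>\<theta> ^ (m + e' * i)\<close> for \<open>i < s\<close>; the fibres of \<open>x \<mapsto> x ^ f\<close> are these cosets.\<close>

definition coset_union :: "nat \<Rightarrow> nat \<Rightarrow> nat \<Rightarrow> nat \<Rightarrow> 'a set" where
  "coset_union m e' f s = {x. x ^ f \<in> (\<lambda>i. \<theta> ^ ((m + e' * i) * f)) ` {..<s}}"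

text \<open>The \<open>f\<close> listed elements are distinct and lie in the fibre, which consists
  of roots of a polynomial of degree at most \<open>f\<close>.\<close>

lemma fibre_eq:
  assumes "N = e * f"
  shows "{y. y ^ f = \<theta> ^ (m * f)} = (\<lambda>k. \<theta> ^ (m + e * k)) ` {..<f}" (is "?L = ?R")
    and "card {y. y ^ f = \<theta> ^ (m * f)} = f"
proof -
  have f: "f > 0" and e: "e > 0" using N_pos assms by auto
  have "inj_on (\<lambda>k. \<theta> ^ (m + e * k)) {..<f}"
  proof (rule inj_onI)
    fix k k' assume k: "k \<in> {..<f}" "k' \<in> {..<f}" "\<theta> ^ (m + e * k) = \<theta> ^ (m + e * k')"
    then have "\<theta> ^ (e * k) = \<theta> ^ (e * k')"
      using theta_nz by (simp add: power_add)
    then have "e * (k mod f) = e * (k' mod f)"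
      by (simp add: power_eq_iff assms)
    with k e show "k = k'" by simp
  qed
  then have cR: "card ?R = f"
    by (simp add: card_image)
  have RL: "?R \<subseteq> ?L"
  proof
    fix y assume "y \<in> ?R"
    then obtain k where "y = \<theta> ^ (m + e * k)" by auto
    then have "y ^ f = \<theta> ^ (m * f) * (\<theta> ^ N) ^ k"
      by (simp add: assms algebra_simps flip: power_add power_mult)
    then show "y \<in> ?L" by (simp add: power_N[OF theta_nz])
  qed
  let ?p = "monom 1 f - [:\<theta> ^ (m * f):]"
  have coeff_p: "coeff ?p f = 1"
    using f by (cases f) auto
  have "?p \<noteq> 0"
  proof
    assume "?p = 0"
    then have "coeff ?p f = 0" by (simp only: coeff_0)
    with coeff_p show False by simp
  qed
  have "card ?L \<le> card {x. poly ?p x = 0}"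
    by (simp add: poly_monom)
  also have "\<dots> \<le> degree ?p"
    by (rule card_poly_roots_bound) fact
  also have "\<dots> \<le> f"
    by (intro degree_diff_le) (auto intro: degree_monom_le)
  finally have "card ?L \<le> card ?R"
    unfolding cR .
  with RL show LR: "?L = ?R"
    by (metis card_seteq finite)
  show "card ?L = f"
    unfolding LR by (rule cR)
qed

context
  fixes m e e' f s :: nat
  assumes N_eq: "N = e * f" and s: "s \<le> e div gcd e e'"
begin

text \<open>A coincidence forces \<open>e dvd e' * (j - i)\<close>, so \<open>e div gcd e e'\<close>
  divides \<open>j - i\<close>, which is positive and less than \<open>s\<close>.\<close>

lemma coset_reps_inj: "inj_on (\<lambda>i. \<theta> ^ ((m + e' * i) * f)) {..<s}"
proof (rule linorder_inj_onI)
  fix i j assume ij: "i < j" "i \<in> {..<s}" "j \<in> {..<s}"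
  have e: "e > 0" and f: "f > 0" using N_pos N_eq by auto
  show "\<theta> ^ ((m + e' * i) * f) \<noteq> \<theta> ^ ((m + e' * j) * f)"
  proof
    assume "\<theta> ^ ((m + e' * i) * f) = \<theta> ^ ((m + e' * j) * f)"
    moreover have "(m + e' * j) * f = (m + e' * i) * f + e' * (j - i) * f"
    proof -
      obtain d where "j = i + d"
        using ij less_imp_add_positive by blast
      then show ?thesis by (simp add: algebra_simps)
    qed
    ultimately have "\<theta> ^ (e' * (j - i) * f) = 1"
      using theta_nz by (simp add: power_add)
    then have "e dvd e' * (j - i)"
      using f by (simp add: power_eq_1_iff N_eq)
    moreover obtain a b where ab: "e = a * gcd e e'" "e' = b * gcd e e'" "coprime a b"
      using gcd_coprime_exists[of e e'] e by auto
    ultimately have "a * gcd e e' dvd b * (j - i) * gcd e e'"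
      by (metis mult.assoc mult.commute)
    then have "a dvd b * (j - i)"
      using e by simp
    then have "a dvd j - i"
      using ab by (simp add: coprime_dvd_mult_right_iff)
    moreover have "a = e div gcd e e'"
      using ab(1) e by (metis gcd_eq_0_iff nonzero_mult_div_cancel_right not_gr0)
    ultimately have "e div gcd e e' dvd j - i" by simp
    then show False
      using ij s by (auto dest: dvd_imp_le)
  qed
qed auto

lemma coset_union_Union:
  "coset_union m e' f s = (\<Union>i<s. {y. y ^ f = \<theta> ^ ((m + e' * i) * f)})"
  by (auto simp: coset_union_def)

lemma coset_unionE:
  assumes "x \<in> coset_union m e' f s"
  obtains i k where "i < s" "x ^ f = \<theta> ^ ((m + e' * i) * f)" "x = \<theta> ^ (m + e' * i + e * k)"
proof -
  obtain i where i: "i < s" "x \<in> {y. y ^ f = \<theta> ^ ((m + e' * i) * f)}"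
    using assms by (auto simp: coset_union_def)
  with fibre_eq(1)[OF N_eq, of "m + e' * i"] obtain k where "x = \<theta> ^ (m + e' * i + e * k)"
    by blast
  with i that show ?thesis by auto
qed

lemma coset_union_disjoint:
  assumes "i \<in> {..<s}" "j \<in> {..<s}" "i \<noteq> j"
  shows "{y. y ^ f = \<theta> ^ ((m + e' * i) * f)} \<inter> {y. y ^ f = \<theta> ^ ((m + e' * j) * f)} = {}"
  using inj_onD[OF coset_reps_inj _ assms(1,2)] assms(3) by auto

lemma card_coset_union: "card (coset_union m e' f s) = s * f"
  unfolding coset_union_Union
  by (subst card_UN_disjoint) (use coset_union_disjoint fibre_eq(2)[OF N_eq] in auto)

lemma prod_coset_union:
  "(\<Prod>y\<in>coset_union m e' f s. x - y) = (\<Prod>i<s. x ^ f - \<theta> ^ ((m + e' * i) * f))"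
proof -
  have f: "f > 0" using N_pos N_eq by auto
  have "(\<Prod>y\<in>coset_union m e' f s. x - y) = (\<Prod>i<s. \<Prod>y | y ^ f = \<theta> ^ ((m + e' * i) * f). x - y)"
    unfolding coset_union_Union
    by (rule prod.UNION_disjoint) (use coset_union_disjoint in auto)
  then show ?thesis
    by (simp only: prod_power_fibre_eval[OF f fibre_eq(2)[OF N_eq]])
qed

text \<open>The fibre containing \<open>x\<close> contributes the derivative of the power map, every
  other fibre a difference of \<open>f\<close>th powers.\<close>

lemma prod_coset_union_deriv:
  assumes i: "i < s" and x: "x ^ f = \<theta> ^ ((m + e' * i) * f)"
  shows "(\<Prod>y\<in>coset_union m e' f s - {x}. x - y) =
    of_nat f * x ^ (f - 1) * (\<Prod>j\<in>{..<s}-{i}. x ^ f - \<theta> ^ ((m + e' * j) * f))"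
proof -
  let ?F = "\<lambda>j. {y. y ^ f = \<theta> ^ ((m + e' * j) * f)}"
  have f: "f > 0" using N_pos N_eq by auto
  have "coset_union m e' f s - {x} = (?F i - {x}) \<union> (\<Union>j\<in>{..<s}-{i}. ?F j)"
  proof -
    have "x \<notin> ?F j" if "j \<in> {..<s} - {i}" for j
      using coset_union_disjoint[of i j] i x that by auto
    then show ?thesis
      unfolding coset_union_Union using i by auto
  qed
  moreover have "(?F i - {x}) \<inter> (\<Union>j\<in>{..<s}-{i}. ?F j) = {}"
  proof -
    have "?F i \<inter> ?F j = {}" if "j \<in> {..<s} - {i}" for j
      using coset_union_disjoint[of i j] i that by auto
    then show ?thesis by blast
  qed
  ultimately have "(\<Prod>y\<in>coset_union m e' f s - {x}. x - y) =
      (\<Prod>y\<in>?F i - {x}. x - y) * (\<Prod>y\<in>(\<Union>j\<in>{..<s}-{i}. ?F j). x - y)"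
    by (simp add: prod.union_disjoint)
  also have "(\<Prod>y\<in>?F i - {x}. x - y) = of_nat f * x ^ (f - 1)"
    using prod_power_fibre_deriv[OF f, of x] fibre_eq(2)[OF N_eq, of "m + e' * i"] by (simp add: x)
  also have "(\<Prod>y\<in>(\<Union>j\<in>{..<s}-{i}. ?F j). x - y) =
      (\<Prod>j\<in>{..<s}-{i}. x ^ f - \<theta> ^ ((m + e' * j) * f))"
    unfolding prod_power_fibre_eval[OF f fibre_eq(2)[OF N_eq], symmetric]
    by (rule prod.UNION_disjoint) (use coset_union_disjoint in auto)
  finally show ?thesis .
qed

end

end

section \<open>Fields of square order\<close>

text \<open>The solutions of \<open>x ^ r = x\<close> are the subfield of order \<open>r\<close>,
  and \<open>x ^ (r + 1)\<close> is the norm to it.\<close>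

locale square_order_field = primitive_element \<theta> N
  for \<theta> :: "'a::{finite,field}" and N :: nat +
  fixes r :: nat
  assumes card: "card (UNIV :: 'a set) = r ^ 2"
    and odd_r: "odd r"
    and frobenius: "(x + y :: 'a) ^ r = x ^ r + y ^ r"
begin

definition h :: nat where "h = (r + 1) div 2"

text \<open>Half the order of the multiplicative group, written so that Euler's criterion becomes a
  condition on the \<open>h\<close>th power of \<open>x ^ (r - 1)\<close>.\<close>

definition M :: nat where "M = (r - 1) * h"

lemma r_pos: "r > 0"
  using odd_r by (auto intro: Nat.gr0I)

lemma two_h: "2 * h = r + 1"
  using odd_r by (simp add: h_def)

lemma N_r: "N = (r - 1) * (r + 1)"
  using r_pos by (cases r) (simp_all add: N card power2_eq_square algebra_simps)

lemma two_M: "N = 2 * M"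
  unfolding M_def N_r two_h[symmetric] by (simp only: mult_ac)

lemma frobenius_diff: "(x - y :: 'a) ^ r = x ^ r - y ^ r"
  using frobenius[of "x - y" y] by (simp add: algebra_simps)

lemma of_nat_frobenius: "(of_nat k :: 'a) ^ r = of_nat k"
  using r_pos by (induction k) (simp_all add: frobenius)

text \<open>\<open>M\<close> is a multiple of \<open>r - 1\<close>, so Euler's criterion
  holds.\<close>

lemma subfield_square:
  assumes "x \<noteq> (0 :: 'a)" "x ^ r = x"
  shows "nonzero_square x"
proof (rule euler_square[OF two_M])
  have "x * x ^ (r - 1) = x ^ r"
    using r_pos by (simp flip: power_Suc)
  then have "x ^ (r - 1) = 1"
    using assms by simp
  then show "x ^ M = 1"
    by (simp add: M_def power_mult)
qed

lemma of_nat_card: "of_nat (r ^ 2) = (0 :: 'a)"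
  using CHAR_dvd_CARD[where ?'a = 'a] by (simp add: of_nat_eq_0_iff_char_dvd card del: of_nat_power)

text \<open>In the field \<open>e * f\<close> equals \<open>-1\<close>, so \<open>f\<close> is
  nonzero there; as a multiple of 1 it lies in the subfield.\<close>

lemma of_nat_factor_square:
  assumes "N = e * f"
  shows "nonzero_square (of_nat f :: 'a)"
proof (rule subfield_square[OF _ of_nat_frobenius])
  have "of_nat e * of_nat f + 1 = (of_nat (N + 1) :: 'a)"
    by (simp add: assms)
  also have "N + 1 = r ^ 2"
    using N card N_pos by simp
  finally have "of_nat e * of_nat f + 1 = (0 :: 'a)"
    using of_nat_card by simp
  then show "of_nat f \<noteq> (0 :: 'a)"
    by auto
qed

lemma minus_one_neq_one: "(-1 :: 'a) \<noteq> 1"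
proof
  assume "(-1 :: 'a) = 1"
  then have two: "(2 :: 'a) = 0"
    by (metis add.right_inverse one_add_one)
  obtain k where "r ^ 2 = 2 * k + 1"
    using odd_r by (metis even_power oddE)
  then have "of_nat (r ^ 2) = (1 :: 'a)"
    using two by simp
  with of_nat_card show False by simp
qed

lemma minus_one_square: "nonzero_square (-1 :: 'a)"
  using odd_r by (intro subfield_square) auto

text \<open>Raising to the power \<open>r\<close> inverts norm-one elements, so \<open>(u - w) ^ (r - 1) = - 1 / (u * w)\<close>.\<close>

lemma norm_one_diff:
  fixes u w :: 'a
  assumes "u ^ (r + 1) = 1" "w ^ (r + 1) = 1" "u \<noteq> w"
  shows "(u - w) ^ M * (u * w) ^ h = (-1) ^ h"
proof -
  have "(u - w) * ((u - w) ^ (r - 1) * (u * w)) = (u - w) ^ r * (u * w)"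
    using r_pos by (simp flip: power_Suc mult.assoc)
  also have "\<dots> = w * u ^ (r + 1) - u * w ^ (r + 1)"
    by (simp add: frobenius_diff algebra_simps)
  also have "\<dots> = (u - w) * (-1)"
    using assms by simp
  finally have "(u - w) ^ (r - 1) * (u * w) = -1"
    using assms by (simp only: mult_cancel_left) simp
  then have "((u - w) ^ (r - 1) * (u * w)) ^ h = (-1) ^ h"
    by simp
  then show ?thesis
    by (simp add: M_def power_mult power_mult_distrib)
qed

section \<open>The set of evaluation points\<close>

lemma square_points:
  fixes e1 f1 e2 f2 l s t :: nat
  assumes fact: "N = e1 * f1" "N = e2 * f2"
    and l2: "l \<ge> 2"
    and e1_cong: "e1 mod 2 ^ (l + 1) = 2 ^ l"
    and e2_dvd: "2 ^ l dvd e2"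
    and div1: "2 * e2 dvd e1 * (r - 1)"
    and div2: "e1 dvd e2 * (r + 1)"
    and s: "s \<le> e1 div gcd e1 e2"
    and t: "t \<le> e2 div gcd e1 e2"
    and s4: "4 dvd (s - 1) * (r + 1)"
  obtains S :: "'a set" where "card S = s * f1 + t * f2" "\<And>x. x \<in> S \<Longrightarrow> nonzero_square x"
    "\<And>x. x \<in> S \<Longrightarrow> nonzero_square (\<Prod>y\<in>S-{x}. x - y)"
proof -
  have t': "t \<le> e2 div gcd e2 e1"
    using t by (simp add: gcd.commute)
  \<comment> \<open>The congruence says that \<open>2 ^ l\<close> is the exact power of 2 in
    \<open>e1\<close>; the odd part is \<open>2 * c + 1\<close>.\<close>
  define c where "c = e1 div 2 ^ (l + 1)"
  have e1_c: "e1 = 2 ^ l * (2 * c + 1)"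
    using div_mult_mod_eq[of e1 "2 ^ (l + 1)"] e1_cong by (simp add: c_def algebra_simps)
  obtain l' where l': "l = Suc l'" "l' \<ge> 1"
    using l2 by (cases l) auto
  \<comment> \<open>The half step \<open>e1 div 2\<close>, with exact power
    \<open>2 ^ (l - 1)\<close> of 2: it is even since \<open>l \<ge> 2\<close>, but none of its odd
    multiples is divisible by \<open>2 ^ l\<close>.\<close>
  define E where "E = 2 ^ l' * (2 * c + 1)"
  have e1_E: "e1 = 2 * E"
    by (simp add: e1_c E_def l')
  have even_E: "even E"
    using l' by (simp add: E_def)
  have even_e2: "even e2"
    using e2_dvd l2 by (auto elim!: dvdE)
  have E_odd_mult: "\<not> 2 ^ l dvd E * (2 * j + 1)" for j
  proof
    assume "2 ^ l dvd E * (2 * j + 1)"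
    then have "2 ^ l' * 2 dvd 2 ^ l' * ((2 * c + 1) * (2 * j + 1))"
      by (simp only: E_def l' power_Suc mult_ac)
    then have "2 dvd (2 * c + 1) * (2 * j + 1)"
      unfolding nat_mult_dvd_cancel_disj by simp
    then show False by simp
  qed
  have e1_dvd: "e1 dvd e2 * h"
  proof -
    have "e1 dvd 2 * (e2 * h)"
      using div2 unfolding two_h[symmetric] by (simp only: mult_ac)
    then have "2 * c + 1 dvd 2 * (e2 * h)"
      unfolding e1_c using dvd_mult_right by blast
    moreover have "coprime (2 * c + 1) 2"
      by simp
    ultimately have "2 * c + 1 dvd e2 * h"
      using coprime_dvd_mult_right_iff by blast
    moreover have "2 ^ l dvd e2 * h"
      using e2_dvd by simp
    moreover have "coprime (2 ^ l) (2 * c + 1)"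
      by simp
    ultimately show ?thesis
      unfolding e1_c using divides_mult by blast
  qed
  \<comment> \<open>After multiplication by \<open>f2\<close>, the product \<open>e2 * f2\<close>
    becomes \<open>(r - 1) * (r + 1)\<close> and \<open>2 * (r - 1)\<close> cancels.\<close>
  have r1_dvd: "(r + 1) dvd E * f2"
  proof -
    have "2 * e2 * f2 dvd e1 * (r - 1) * f2"
      using div1 by simp
    moreover have "2 * e2 * f2 = (2 * (r - 1)) * (r + 1)"
      using fact(2) N_r by (simp only: mult.assoc)
    moreover have "e1 * (r - 1) * f2 = (2 * (r - 1)) * (E * f2)"
      unfolding e1_E by (simp only: mult_ac)
    ultimately have "(2 * (r - 1)) * (r + 1) dvd (2 * (r - 1)) * (E * f2)"
      by metis
    moreover have "r - 1 > 0"
      using N_pos N_r by (cases "r - 1") auto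
    ultimately show ?thesis
      unfolding nat_mult_dvd_cancel_disj by simp
  qed
  \<comment> \<open>On \<open>A\<close> the \<open>f1\<close>th powers will be powers of
    \<open>b\<close> and the \<open>f2\<close>th powers even powers of \<open>d\<close>; on
    \<open>B\<close> they will be negatives of powers of \<open>b\<close> and odd powers of
    \<open>d\<close>.\<close>
  define b where "b = \<theta> ^ (e2 * f1)"
  define d where "d = \<theta> ^ (E * f2)"
  \<comment> \<open>Stronger than norm one: it removes the factor \<open>(u * w) ^ h\<close> from
    \<open>norm_one_diff\<close>.\<close>
  have b_h: "b ^ h = 1"
  proof -
    have "N dvd e2 * f1 * h"
      using mult_dvd_mono[OF e1_dvd dvd_refl[of f1]] unfolding fact(1) by (simp only: mult_ac)
    then show ?thesis
      by (simp add: b_def power_eq_1_iff flip: power_mult)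
  qed
  have d_r: "d ^ r = d"
  proof -
    have "N dvd E * f2 * (r - 1)"
      using mult_dvd_mono[OF r1_dvd dvd_refl[of "r - 1"]] unfolding N_r by (simp only: mult_ac)
    then have "d ^ (r - 1) = 1"
      by (simp add: d_def power_eq_1_iff flip: power_mult)
    moreover have "d ^ r = d * d ^ (r - 1)"
      using r_pos by (simp flip: power_Suc)
    ultimately show ?thesis by simp
  qed
  have E_f1: "\<theta> ^ (E * f1) = -1"
    using fact(1) e1_E two_M by (intro half_power minus_one_neq_one) simp
  have d_power: "(d ^ k) ^ r = d ^ k" for k
    using d_r by (metis mult.commute power_mult)
  have norm_b: "(b ^ k) ^ h = 1" for k
    using b_h by (metis mult.commute power_mult power_one)
  have norm_b': "(b ^ k) ^ (r + 1) = 1" for k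
    using norm_b[of k] by (metis two_h mult.commute power_mult power_one)
  have repA: "\<theta> ^ ((0 + e2 * i) * f1) = b ^ i" for i
    by (simp add: b_def mult_ac flip: power_mult)
  have repB: "\<theta> ^ ((E + e1 * j) * f2) = d ^ (2 * j + 1)" for j
    by (simp add: d_def e1_E algebra_simps flip: power_mult power_add)
  define A where "A = coset_union 0 e2 f1 s"
  define B where "B = coset_union E e1 f2 t"
  \<comment> \<open>In \<open>x ^ f2\<close> the coset index \<open>i\<close> disappears, because
    \<open>e2 * f2 = N\<close>; only the position \<open>k\<close> inside the coset remains.\<close>
  have memA: "\<exists>i k. i < s \<and> x ^ f1 = b ^ i \<and> x = \<theta> ^ (e2 * i + e1 * k) \<and> x ^ f2 = d ^ (2 * k)"
    if xA: "x \<in> A" for x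
  proof -
    obtain i k where ik: "i < s" "x ^ f1 = \<theta> ^ ((0 + e2 * i) * f1)" "x = \<theta> ^ (0 + e2 * i + e1 * k)"
      using coset_unionE[OF fact(1) s xA[unfolded A_def]] .
    have "x ^ f2 = (\<theta> ^ N) ^ i * d ^ (2 * k)"
      by (simp add: ik(3) d_def fact(2) e1_E algebra_simps flip: power_mult power_add)
    then show ?thesis
      using ik repA power_N[OF theta_nz] by auto
  qed
  \<comment> \<open>In \<open>x ^ f1\<close> the index \<open>j\<close> disappears, because
    \<open>e1 * f1 = N\<close>, and the half step leaves the sign.\<close>
  have memB: "\<exists>j k. j < t \<and> x ^ f2 = d ^ (2 * j + 1) \<and> x = \<theta> ^ (E * (2 * j + 1) + e2 * k)
      \<and> x ^ f1 = - (b ^ k)"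
    if xB: "x \<in> B" for x
  proof -
    obtain j k where jk: "j < t" "x ^ f2 = \<theta> ^ ((E + e1 * j) * f2)" "x = \<theta> ^ (E + e1 * j + e2 * k)"
      using coset_unionE[OF fact(2) t' xB[unfolded B_def]] .
    have "x ^ f1 = (\<theta> ^ (E * f1)) ^ (2 * j + 1) * b ^ k"
      by (simp add: jk(3) b_def e1_E algebra_simps flip: power_mult power_add)
    also have "\<dots> = - (b ^ k)"
      unfolding E_f1 by simp
    finally have "x ^ f1 = - (b ^ k)" .
    moreover have "E + e1 * j + e2 * k = E * (2 * j + 1) + e2 * k"
      by (simp add: e1_E algebra_simps)
    ultimately show ?thesis
      using jk repB by metis
  qed
  have sqA: "nonzero_square x" if "x \<in> A" for x
    using memA[OF that] even_e2 e1_E by (auto intro!: power_even_square)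
  have sqB: "nonzero_square x" if "x \<in> B" for x
    using memB[OF that] even_e2 even_E by (auto intro!: power_even_square)
  \<comment> \<open>Since \<open>2 ^ l dvd N\<close>, exponents of \<open>\<theta>\<close> are well
    defined modulo \<open>2 ^ l\<close>: they vanish there for points of \<open>A\<close> but not
    for points of \<open>B\<close>.\<close>
  have disj: "A \<inter> B = {}"
  proof (rule ccontr)
    assume "A \<inter> B \<noteq> {}"
    then obtain x where x: "x \<in> A" "x \<in> B" by auto
    from memA[OF x(1)] memB[OF x(2)] obtain i k j k' where
      eq: "\<theta> ^ (e2 * i + e1 * k) = \<theta> ^ (E * (2 * j + 1) + e2 * k')"
      by metis
    have dvd: "2 ^ l dvd e1" "2 ^ l dvd N"
      using e1_c fact(1) by auto
    have "(e2 * i + e1 * k) mod 2 ^ l = (E * (2 * j + 1) + e2 * k') mod 2 ^ l"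
      using eq[unfolded power_eq_iff] dvd(2) by (metis mod_mod_cancel)
    moreover have "2 ^ l dvd e2 * i + e1 * k"
      using e2_dvd dvd by simp
    ultimately have "2 ^ l dvd E * (2 * j + 1) + e2 * k'"
      by (metis dvd_eq_mod_eq_0)
    moreover have "2 ^ l dvd e2 * k'"
      using e2_dvd by simp
    ultimately show False
      using E_odd_mult[of j] dvd_add_left_iff by blast
  qed
  have normA: "(u - w) ^ M = (-1) ^ h" if "u ^ (r + 1) = 1" "w ^ (r + 1) = 1" "u \<noteq> w"
      "u ^ h = 1" "w ^ h = 1" for u w :: 'a
    using norm_one_diff[OF that(1-3)] that(4,5) by (simp add: power_mult_distrib)
  show thesis
  proof (rule that[of "A \<union> B"])
    have "card A = s * f1" "card B = t * f2"
      unfolding A_def B_def by (rule card_coset_union[OF fact(1) s], rule card_coset_union[OF fact(2) t'])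
    then show "card (A \<union> B) = s * f1 + t * f2"
      using disj by (simp add: card_Un_disjoint)
    show "nonzero_square x" if "x \<in> A \<union> B" for x
      using that sqA sqB by auto
    fix x assume x: "x \<in> A \<union> B"
    then consider (A) "x \<in> A" "x \<notin> B" | (B) "x \<in> B" "x \<notin> A"
      using disj by auto
    then show "nonzero_square (\<Prod>y\<in>A\<union>B-{x}. x - y)"
    proof cases
      case A
      obtain i k where ik: "i < s" "x ^ f1 = b ^ i" "x ^ f2 = d ^ (2 * k)"
        using \<open>x \<in> A\<close> memA by metis
      have "(\<Prod>y\<in>A\<union>B-{x}. x - y) = (\<Prod>y\<in>A-{x}. x - y) * (\<Prod>y\<in>B. x - y)"
        using A disj by (subst prod.union_disjoint[symmetric]) (auto intro: prod.cong)
      moreover have "nonzero_square (\<Prod>y\<in>A-{x}. x - y)"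
      proof -
        have "(\<Prod>y\<in>A-{x}. x - y) =
            of_nat f1 * x ^ (f1 - 1) * (\<Prod>j\<in>{..<s}-{i}. b ^ i - b ^ j)"
          using prod_coset_union_deriv[OF fact(1) s ik(1), of x 0]
          unfolding A_def repA ik(2) by simp
        moreover have "nonzero_square (\<Prod>j\<in>{..<s}-{i}. b ^ i - b ^ j)"
        proof (rule euler_square[OF two_M])
          have "b ^ i \<noteq> b ^ j" if "j \<in> {..<s} - {i}" for j
            using inj_onD[OF coset_reps_inj[OF fact(1) s, of 0], of i j] that ik(1)
            unfolding repA by auto
          then have "(\<Prod>j\<in>{..<s}-{i}. b ^ i - b ^ j) ^ M = (\<Prod>j\<in>{..<s}-{i}. (-1) ^ h)"
            unfolding prod_power_distrib
            by (intro prod.cong refl normA norm_b norm_b') auto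
          also have "\<dots> = (-1) ^ (h * (s - 1))"
            using ik(1) by (simp add: power_mult)
          \<comment> \<open>Each of the \<open>s - 1\<close> differences contributes the sign
            \<open>(-1) ^ h\<close>. The hypothesis \<open>4 dvd (s - 1) * (r + 1)\<close>, with
            \<open>r + 1 = 2 * h\<close>, makes the total sign 1.\<close>
          also have "even (h * (s - 1))"
          proof -
            have "2 * 2 dvd 2 * (h * (s - 1))"
              using s4 unfolding two_h[symmetric] by (simp add: mult_ac)
            then show ?thesis unfolding nat_mult_dvd_cancel_disj by simp
          qed
          then have "(-1 :: 'a) ^ (h * (s - 1)) = 1"
            by simp
          finally show "(\<Prod>j\<in>{..<s}-{i}. b ^ i - b ^ j) ^ M = 1" .
        qed
        ultimately show ?thesis
          using of_nat_factor_square[OF fact(1)] sqA[OF \<open>x \<in> A\<close>]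
          by (auto intro!: nonzero_square_mult nonzero_square_power)
      qed
      \<comment> \<open>All factors are differences of powers of \<open>d\<close>, hence in the
        subfield; none vanishes since \<open>x\<close> is outside \<open>B\<close>.\<close>
      moreover have "nonzero_square (\<Prod>y\<in>B. x - y)"
      proof (rule subfield_square)
        have eq: "(\<Prod>y\<in>B. x - y) = (\<Prod>j<t. d ^ (2 * k) - d ^ (2 * j + 1))"
          unfolding B_def prod_coset_union[OF fact(2) t'] repB ik(3) ..
        show "(\<Prod>y\<in>B. x - y) ^ r = (\<Prod>y\<in>B. x - y)"
          unfolding eq prod_power_distrib frobenius_diff d_power ..
        show "(\<Prod>y\<in>B. x - y) \<noteq> 0"
          using A by auto
      qed
      ultimately show ?thesis
        by (simp add: nonzero_square_mult)
    next
      case B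
      obtain j k where jk: "j < t" "x ^ f2 = d ^ (2 * j + 1)" "x ^ f1 = - (b ^ k)"
        using \<open>x \<in> B\<close> memB by metis
      have "(\<Prod>y\<in>A\<union>B-{x}. x - y) = (\<Prod>y\<in>B-{x}. x - y) * (\<Prod>y\<in>A. x - y)"
        using B disj by (subst prod.union_disjoint[symmetric]) (auto intro: prod.cong)
      moreover have "nonzero_square (\<Prod>y\<in>B-{x}. x - y)"
      proof -
        have eq: "(\<Prod>y\<in>B-{x}. x - y) =
            of_nat f2 * x ^ (f2 - 1) * (\<Prod>i\<in>{..<t}-{j}. d ^ (2 * j + 1) - d ^ (2 * i + 1))"
          using prod_coset_union_deriv[OF fact(2) t' jk(1), of x E]
          unfolding B_def repB jk(2) by simp
        have "nonzero_square (\<Prod>i\<in>{..<t}-{j}. d ^ (2 * j + 1) - d ^ (2 * i + 1))"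
        proof (rule subfield_square)
          show "(\<Prod>i\<in>{..<t}-{j}. d ^ (2 * j + 1) - d ^ (2 * i + 1)) ^ r =
              (\<Prod>i\<in>{..<t}-{j}. d ^ (2 * j + 1) - d ^ (2 * i + 1))"
            unfolding prod_power_distrib frobenius_diff d_power ..
          \<comment> \<open>The full product is nonzero, hence so is its factor made of powers of
            \<open>d\<close>.\<close>
          have "(\<Prod>y\<in>B-{x}. x - y) \<noteq> 0"
            by auto
          then show "(\<Prod>i\<in>{..<t}-{j}. d ^ (2 * j + 1) - d ^ (2 * i + 1)) \<noteq> 0"
            unfolding eq by (metis mult_zero_right)
        qed
        then show ?thesis
          unfolding eq using of_nat_factor_square[OF fact(2)] sqB[OF \<open>x \<in> B\<close>]
          by (auto intro!: nonzero_square_mult nonzero_square_power)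
      qed
      moreover have "nonzero_square (\<Prod>y\<in>A. x - y)"
      proof (rule euler_square[OF two_M])
        have eq: "(\<Prod>y\<in>A. x - y) = (\<Prod>i<s. - (b ^ k) - b ^ i)"
          unfolding A_def prod_coset_union[OF fact(1) s] repA jk(3) ..
        have "(\<Prod>y\<in>A. x - y) \<noteq> 0"
          using B by auto
        \<comment> \<open>An equality would make the product over \<open>A\<close> vanish, although
          \<open>x\<close> is not in \<open>A\<close>.\<close>
        then have ne: "- (b ^ k) \<noteq> b ^ i" if "i < s" for i
          unfolding eq using that by auto
        \<comment> \<open>With \<open>u = - (b ^ k)\<close> and \<open>w = b ^ i\<close>, the factor
          \<open>(u * w) ^ h\<close> equals \<open>(-1) ^ h\<close> and cancels the sign in
          \<open>norm_one_diff\<close>.\<close>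
        have "(- (b ^ k) - b ^ i) ^ M = 1" if "i < s" for i
        proof -
          have "even (r + 1)" using odd_r by simp
          then have "(- (b ^ k)) ^ (r + 1) = 1"
            using norm_b'[of k] by (simp only: power_minus_even)
          from norm_one_diff[OF this norm_b' ne[OF that]]
          have "(- (b ^ k) - b ^ i) ^ M * ((-1) ^ h * ((b ^ k) ^ h * (b ^ i) ^ h)) = (-1) ^ h"
            by (simp add: power_mult_distrib[symmetric])
          then show ?thesis
            by (simp add: norm_b)
        qed
        then show "(\<Prod>y\<in>A. x - y) ^ M = 1"
          unfolding eq prod_power_distrib by simp
      qed
      ultimately show ?thesis
        by (simp add: nonzero_square_mult)
    qed
  qed
qed

end

section \<open>Codes from the evaluation points\<close>

theorem theorem3:
  fixes r q e1 f1 e2 f2 l s t n1 :: nat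
  assumes r_pp: "\<exists>p m. prime p \<and> odd p \<and> m \<ge> 1 \<and> r = p ^ m"
    and q_def: "q = r ^ 2"
    and card_F: "card (UNIV :: 'a::{finite,field} set) = q"
    and pos: "e1 > 0" "f1 > 0" "e2 > 0" "f2 > 0"
    and fact1: "q - 1 = e1 * f1" and fact2: "q - 1 = e2 * f2"
    and l2: "l \<ge> 2"
    and e1_cong: "e1 mod 2 ^ (l + 1) = 2 ^ l"
    and e2_dvd: "2 ^ l dvd e2"
    and div1: "2 * e2 dvd e1 * (r - 1)"
    and div2: "e1 dvd e2 * (r + 1)"
    and s_bd: "1 \<le> s" "s \<le> e1 div gcd e1 e2"
    and t_bd: "1 \<le> t" "t \<le> e2 div gcd e1 e2"
    and s4: "4 dvd (s - 1) * (r + 1)"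
    and n1_def: "n1 = s * f1 + t * f2"
  shows "(even n1 \<longrightarrow> (\<forall>k. 1 \<le> k \<and> k \<le> n1 div 2 - 1 \<longrightarrow>
            (\<exists>C :: (nat \<Rightarrow> 'a) set. MDS_code n1 k C \<and> self_orthogonal n1 C)))
       \<and> (even n1 \<longrightarrow>
            (\<exists>C :: (nat \<Rightarrow> 'a) set. \<exists>k. MDS_code (n1 + 1) k C \<and> almost_self_dual (n1 + 1) C))
       \<and> (even (n1 + 1) \<longrightarrow> (\<forall>k. 1 \<le> k \<and> k \<le> (n1 + 1) div 2 - 1 \<longrightarrow>
            (\<exists>C :: (nat \<Rightarrow> 'a) set. MDS_code (n1 + 1) k C \<and> self_orthogonal (n1 + 1) C)))"
proof -
  obtain p m where pm: "prime p" "odd p" "r = p ^ m"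
    using r_pp by auto
  have char_prime: "prime CHAR('a)"
    using finite_imp_CHAR_pos[where ?'a = 'a] prime_CHAR_semidom[where ?'a = 'a] by simp
  \<comment> \<open>The characteristic is a prime dividing a power of \<open>p\<close>, so it is
    \<open>p\<close>; thus \<open>r\<close> is a power of it and \<open>x ^ r\<close> is
    additive.\<close>
  have "CHAR('a) dvd p ^ (m * 2)"
    using CHAR_dvd_CARD[where ?'a = 'a] card_F by (simp add: q_def pm power_mult)
  then have char: "CHAR('a) = p"
    using char_prime pm(1) by (metis prime_dvd_power primes_dvd_imp_eq)
  obtain \<theta> :: 'a where \<theta>: "\<theta> \<noteq> 0" "\<And>x. x \<noteq> 0 \<Longrightarrow> \<exists>i. x = \<theta> ^ i"
    using ex_power_generator by blast
  interpret square_order_field \<theta> "q - 1" r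
  proof
    show "(x + y :: 'a) ^ r = x ^ r + y ^ r" for x y
      using char_prime by (rule freshmans_dream') (simp add: pm char)
  qed (use \<theta> card_F q_def pm in auto)
  obtain S :: "'a set" where S: "card S = n1" "\<And>x. x \<in> S \<Longrightarrow> nonzero_square x"
    "\<And>x. x \<in> S \<Longrightarrow> nonzero_square (\<Prod>y\<in>S-{x}. x - y)"
    using square_points[OF fact1 fact2 l2 e1_cong e2_dvd div1 div2 s_bd(2) t_bd(2) s4]
    unfolding n1_def by metis
  have zero: "0 \<notin> S"
    using S(2)[of 0] by (auto simp: nonzero_square_def)
  have root: "\<exists>w. w ^ 2 = x" if "nonzero_square x" for x :: 'a
    using that by (auto simp: nonzero_square_def)
  obtain a v :: "nat \<Rightarrow> 'a" where av: "self_dual_grs n1 a v"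
    using square_products_self_dual_grs[of S] S root by (metis finite)
  \<comment> \<open>Adding 0 multiplies the old difference products by the square \<open>x\<close>.
    At 0 itself the product consists of negated points, which are squares because \<open>-1\<close>
    is one.\<close>
  have "nonzero_square (\<Prod>y\<in>insert 0 S - {x}. x - y)" if "x \<in> insert 0 S" for x
  proof (cases "x = 0")
    case True
    then have "(\<Prod>y\<in>insert 0 S - {x}. x - y) = (\<Prod>y\<in>S. (-1) * y)"
      using zero by simp
    also have "nonzero_square \<dots>"
      by (intro nonzero_square_prod nonzero_square_mult minus_one_square S)
    finally show ?thesis .
  next
    case False
    then have "insert 0 S - {x} = insert 0 (S - {x})" by auto
    then have "(\<Prod>y\<in>insert 0 S - {x}. x - y) = x * (\<Prod>y\<in>S - {x}. x - y)"
      using zero by simp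
    then show ?thesis
      using S False that by (auto intro!: nonzero_square_mult)
  qed
  moreover have "card (insert 0 S) = n1 + 1"
    using S(1) zero by simp
  ultimately obtain a' v' :: "nat \<Rightarrow> 'a" where av': "self_dual_grs (n1 + 1) a' v'"
    using square_products_self_dual_grs[of "insert 0 S"] root by (metis finite)
  interpret C: self_dual_grs n1 a v by fact
  interpret D: self_dual_grs "n1 + 1" a' v' by fact
  have n1_pos: "n1 > 0"
    using pos s_bd(1) n1_def by simp
  show ?thesis
  proof (intro conjI impI allI)
    fix k assume "even n1" "1 \<le> k \<and> k \<le> n1 div 2 - 1"
    then show "\<exists>C :: (nat \<Rightarrow> 'a) set. MDS_code n1 k C \<and> self_orthogonal n1 C"
      by (intro exI[of _ "C.code k"] conjI C.MDS_code C.self_orthogonal) auto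
  next
    assume "even n1"
    \<comment> \<open>The dimension is \<open>n1 div 2\<close>, so that the length is
      \<open>2 * k + 1\<close>; it is at least 1 since \<open>n1\<close> is even and
      positive.\<close>
    then show "\<exists>C :: (nat \<Rightarrow> 'a) set. \<exists>k. MDS_code (n1 + 1) k C \<and> almost_self_dual (n1 + 1) C"
      using n1_pos
      by (intro exI[of _ "D.code (n1 div 2)"] exI[of _ "n1 div 2"] conjI D.MDS_code D.almost_self_dual)
        (auto elim: evenE)
  next
    fix k assume "even (n1 + 1)" "1 \<le> k \<and> k \<le> (n1 + 1) div 2 - 1"
    then show "\<exists>C :: (nat \<Rightarrow> 'a) set. MDS_code (n1 + 1) k C \<and> self_orthogonal (n1 + 1) C"
      by (intro exI[of _ "D.code k"] conjI D.MDS_code D.self_orthogonal) auto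
  qed
qed

end
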